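(* Let $Y$ be a totally disconnected compact space and $f\colon Y\to 2^\omega$ a continuous surjection such that $\lambda\big(f[U]\cap f[Y\setminus U]\big)=0$ for every clopen $U\subseteq Y$. For every $n\in\omega$, $i\in\{0,1\}$ and $s\in 2^n$ let $x_s^i\in 2^\omega$ be the concatenation of $s$ with the infinite constant sequence with value $i$, and fix $y_s^i\in f^{-1}(x_s^i)$. For every $n\in\omega$ define the measure on $Y$ $$\nu_n=\frac{1}{2^{n+1}}\sum_{s\in 2^n}\big(\delta_{y_s^1}-\delta_{y_s^0}\big).$$ Then the sequence $\langle\nu_n\colon n\in\omega\rangle$ is an fsJN-sequence on $Y$.
   Context: All compact spaces are Hausdorff. $\lambda$ denotes the standard product probability measure on the Cantor space $2^\omega$; $\delta_y$ is the Dirac measure at $y$. An fsJN-sequence on a compact space $Y$ is a sequence $\langle\mu_n\colon n\in\omega\rangle$ of finitely supported signed Radon measures on $Y$ with total variation norm $\|\mu_n\|=1$ for every $n$ and $\lim_{n}\int_Y g\,d\mu_n=0$ for every continuous $g\colon Y\to\mathbb{R}$. *)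

theory Defs
  imports "HOL-Probability.Probability"
begin

text \<open>
  The Cantor space is the type \<open>nat \<Rightarrow> bool\<close> with its product topology (\<open>False\<close> is 0, \<open>True\<close> is 1),
  and a compact Hausdorff space is a type of class \<open>t2_space\<close> whose universe is compact.
\<close>

definition totally_disconnected :: "'a::topological_space set \<Rightarrow> bool" where
  "totally_disconnected S \<longleftrightarrow> (\<forall>x\<in>S. connected_component_set S x = {x})"

definition cantor_measure :: "(nat \<Rightarrow> bool) measure" where
  "cantor_measure = (\<Pi>\<^sub>M i\<in>UNIV. uniform_count_measure (UNIV :: bool set))"

definition append_const :: "bool list \<Rightarrow> bool \<Rightarrow> nat \<Rightarrow> bool" where
  "append_const s i = (\<lambda>k. if k < length s then s ! k else i)"

text \<open>
  A finite signed Borel measure is represented by a real-valued set function, of which only the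
  values on Borel sets are ever used.
\<close>

definition signed_measure :: "('a::topological_space set \<Rightarrow> real) \<Rightarrow> bool" where
  "signed_measure \<mu> \<longleftrightarrow> \<mu> {} = 0 \<and>
     (\<forall>A :: nat \<Rightarrow> 'a set. range A \<subseteq> sets borel \<longrightarrow> disjoint_family A \<longrightarrow>
        (\<lambda>i. \<mu> (A i)) sums \<mu> (\<Union>i. A i))"

text \<open>
  The upper variation of \<open>\<mu>\<close>. Since \<open>ennreal\<close> truncates negative reals to \<open>0 = \<mu> {}\<close>, it does not
  change the supremum. The lower variation is the upper variation of \<open>- \<mu>\<close>.
\<close>

definition upper_variation :: "('a::topological_space set \<Rightarrow> real) \<Rightarrow> 'a set \<Rightarrow> ennreal" where
  "upper_variation \<mu> A = (SUP B\<in>{B \<in> sets borel. B \<subseteq> A}. ennreal (\<mu> B))"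

definition lower_variation :: "('a::topological_space set \<Rightarrow> real) \<Rightarrow> 'a set \<Rightarrow> ennreal" where
  "lower_variation \<mu> = upper_variation (\<lambda>B. - \<mu> B)"

definition total_variation :: "('a::topological_space set \<Rightarrow> real) \<Rightarrow> 'a set \<Rightarrow> ennreal" where
  "total_variation \<mu> A = upper_variation \<mu> A + lower_variation \<mu> A"

definition tv_norm :: "('a::topological_space set \<Rightarrow> real) \<Rightarrow> ennreal" where
  "tv_norm \<mu> = total_variation \<mu> UNIV"

definition signed_radon_measure :: "('a::t2_space set \<Rightarrow> real) \<Rightarrow> bool" where
  "signed_radon_measure \<mu> \<longleftrightarrow> signed_measure \<mu> \<and>
     (\<forall>A\<in>sets borel. \<forall>e>0. \<exists>K. compact K \<and> K \<subseteq> A \<and> total_variation \<mu> (A - K) < e)"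

definition signed_support :: "('a::topological_space set \<Rightarrow> real) \<Rightarrow> 'a set" where
  "signed_support \<mu> = {x. \<forall>U. open U \<longrightarrow> x \<in> U \<longrightarrow> total_variation \<mu> U > 0}"

text \<open>
  By the Jordan decomposition theorem, the upper and lower variations of a signed measure are
  measures on the Borel sets (so the countable additivity check built into \<open>measure_of\<close> succeeds);
  integration against \<open>\<mu>\<close> is integration against their difference.
\<close>

definition signed_integral :: "('a::topological_space set \<Rightarrow> real) \<Rightarrow> ('a \<Rightarrow> real) \<Rightarrow> real" where
  "signed_integral \<mu> g =
     (LINT x|measure_of UNIV (sets borel) (upper_variation \<mu>). g x) -
     (LINT x|measure_of UNIV (sets borel) (lower_variation \<mu>). g x)"

definition fsJN_sequence :: "(nat \<Rightarrow> 'a::t2_space set \<Rightarrow> real) \<Rightarrow> bool" where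
  "fsJN_sequence \<mu> \<longleftrightarrow>
     (\<forall>n. signed_radon_measure (\<mu> n) \<and> finite (signed_support (\<mu> n)) \<and> tv_norm (\<mu> n) = 1) \<and>
     (\<forall>g. continuous_on UNIV g \<longrightarrow> (\<lambda>n. signed_integral (\<mu> n) g) \<longlonglongrightarrow> 0)"

end

theory Submission
  imports Defs
begin

text \<open>
  The integral of a function \<open>h\<close> against \<open>\<nu> n\<close> is the average, over the \<open>2 ^ n\<close> words \<open>s\<close> of length \<open>n\<close>,
  of half the difference of the values of \<open>h\<close> at the two points chosen over the cylinder of \<open>s\<close>
  (\<open>end_difference\<close>). It has to be shown that this tends to 0 for continuous \<open>h\<close>.

  Suppose first that \<open>h\<close> is the indicator of a clopen set \<open>U\<close>. A word \<open>s\<close> contributes only if one of its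
  two points lies in \<open>U\<close> and the other does not, and then the cylinder of \<open>s\<close> meets both the image of
  \<open>U\<close> and the image of its complement. The union of these cylinders decreases, as the length grows,
  to the intersection of the two images, because the images are closed. That intersection is null by
  hypothesis, so the probability of the union, which is the fraction of such words, tends to 0
  (\<open>split_words_fraction_tendsto_0\<close>). This gives \<open>end_difference_clopen_tendsto_0\<close>.

  Since the space is compact and totally disconnected, clopen sets separate points, and the
  Stone--Weierstrass theorem approximates each continuous function uniformly by linear combinations
  of indicators of clopen sets (\<open>finite_range_approximation\<close>). The functionals are bounded by the
  supremum norm, so the convergence extends to every continuous function.

  Finally, the points \<open>y i s\<close> for \<open>s\<close> of length \<open>n\<close> are pairwise distinct because their images are, so
  \<open>\<nu> n\<close> is a combination of distinct point masses with weights of absolute value \<open>1 / 2 ^ (n + 1)\<close>. For such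
  measures the variations, the norm, the support and the integral are explicit finite sums, which
  are computed in the locale \<open>point_masses\<close>.
\<close>

section \<open>Finitely supported signed measures\<close>

text \<open>
  The values of \<open>\<mu>\<close> are prescribed on Borel sets only, because \<^term>\<open>return borel x\<close> has measure 0 on
  every non-Borel set, even on one that contains \<open>x\<close>.
\<close>

locale point_masses =
  fixes \<mu> :: "'a::t2_space set \<Rightarrow> real" and F :: "'a set" and w :: "'a \<Rightarrow> real"
  assumes finite_atoms: "finite F"
    and mass: "B \<in> sets borel \<Longrightarrow> \<mu> B = (\<Sum>x\<in>F. w x * indicator B x)"
begin

lemma point_masses_uminus: "point_masses (\<lambda>B. - \<mu> B) F (\<lambda>x. - w x)"
  by unfold_locales (simp_all add: finite_atoms mass sum_negf)

text \<open>
  The supremum is attained at the set of those atoms in \<open>A\<close> that have positive weight. This set is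
  finite, hence Borel, so the formula holds for every \<open>A\<close>, Borel or not.
\<close>

lemma upper_variation_eq:
  "upper_variation \<mu> A = ennreal (\<Sum>x\<in>F. max 0 (w x) * indicator A x)"
proof (rule antisym)
  show "upper_variation \<mu> A \<le> ennreal (\<Sum>x\<in>F. max 0 (w x) * indicator A x)"
    unfolding upper_variation_def
  proof (rule SUP_least)
    fix B assume "B \<in> {B \<in> sets borel. B \<subseteq> A}"
    then have B: "B \<in> sets borel" "B \<subseteq> A" by auto
    show "ennreal (\<mu> B) \<le> ennreal (\<Sum>x\<in>F. max 0 (w x) * indicator A x)"
      unfolding mass[OF B(1)]
      by (intro ennreal_leI sum_mono) (use B(2) in \<open>auto simp: indicator_def\<close>)
  qed
next
  define P where "P = {x \<in> F. x \<in> A \<and> 0 < w x}"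
  have P: "P \<in> sets borel" "P \<subseteq> A"
    using finite_atoms by (auto simp: P_def intro!: borel_closed finite_imp_closed)
  have "\<mu> P = (\<Sum>x\<in>F. max 0 (w x) * indicator A x)"
    unfolding mass[OF P(1)] by (rule sum.cong) (auto simp: P_def indicator_def)
  then show "ennreal (\<Sum>x\<in>F. max 0 (w x) * indicator A x) \<le> upper_variation \<mu> A"
    unfolding upper_variation_def using P by (intro SUP_upper2[of P]) auto
qed

lemma lower_variation_eq:
  "lower_variation \<mu> A = ennreal (\<Sum>x\<in>F. max 0 (- w x) * indicator A x)"
  unfolding lower_variation_def
  by (rule point_masses.upper_variation_eq[OF point_masses_uminus])

lemma total_variation_eq:
  "total_variation \<mu> A = ennreal (\<Sum>x\<in>F. \<bar>w x\<bar> * indicator A x)"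
proof -
  have "(\<Sum>x\<in>F. \<bar>w x\<bar> * indicator A x)
      = (\<Sum>x\<in>F. max 0 (w x) * indicator A x) + (\<Sum>x\<in>F. max 0 (- w x) * indicator A x)"
    unfolding sum.distrib[symmetric] by (rule sum.cong) (auto simp: max_def)
  then show ?thesis
    unfolding total_variation_def upper_variation_eq lower_variation_eq
    by (simp add: ennreal_plus sum_nonneg)
qed

lemma tv_norm_eq: "tv_norm \<mu> = ennreal (\<Sum>x\<in>F. \<bar>w x\<bar>)"
  by (simp add: tv_norm_def total_variation_eq)

lemma signed_measure: "signed_measure \<mu>"
  unfolding signed_measure_def
proof (intro conjI allI impI)
  show "\<mu> {} = 0"
    by (simp add: mass)
next
  fix A :: "nat \<Rightarrow> 'a set"
  assume A: "range A \<subseteq> sets borel" "disjoint_family A"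
  have "(\<lambda>i. \<Sum>x\<in>F. w x * indicator (A i) x) sums (\<Sum>x\<in>F. w x * indicator (\<Union>i. A i) x)"
    using A(2) by (intro sums_sum sums_mult indicator_sums) (auto simp: disjoint_family_on_def)
  moreover have "A i \<in> sets borel" for i
    using A(1) by auto
  ultimately show "(\<lambda>i. \<mu> (A i)) sums \<mu> (\<Union>i. A i)"
    by (simp add: mass sets.countable_UN)
qed

lemma signed_radon_measure: "signed_radon_measure \<mu>"
  unfolding signed_radon_measure_def
proof (intro conjI ballI allI impI signed_measure)
  fix A :: "'a set" and e :: ennreal assume "0 < e"
  have "total_variation \<mu> (A - F \<inter> A) = 0"
    by (simp add: total_variation_eq indicator_def)
  then show "\<exists>K. compact K \<and> K \<subseteq> A \<and> total_variation \<mu> (A - K) < e"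
    using \<open>0 < e\<close> finite_atoms by (intro exI[of _ "F \<inter> A"]) (auto intro: finite_imp_compact)
qed

lemma finite_signed_support: "finite (signed_support \<mu>)"
proof (rule finite_subset[OF _ finite_atoms], rule subsetI, rule ccontr)
  fix x assume x: "x \<in> signed_support \<mu>" "x \<notin> F"
  have "open (- F)"
    using finite_atoms by (intro open_Compl finite_imp_closed)
  moreover have "total_variation \<mu> (- F) = 0"
    by (simp add: total_variation_eq indicator_def)
  ultimately show False
    using x by (auto simp: signed_support_def)
qed

end

text \<open>
  Integration against a variation is integration against a measure built by \<^const>\<open>measure_of\<close>. That
  measure is the image on the Borel sets of a point measure on the finite set \<open>F\<close>, for which the
  integral is known to be a finite sum.
\<close>

lemma integral_weighted_point_masses:
  fixes g :: "'a::t2_space \<Rightarrow> real"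
  assumes F: "finite F" and v: "\<And>x. x \<in> F \<Longrightarrow> 0 \<le> v x" and g: "g \<in> borel_measurable borel"
  shows "(LINT x|measure_of UNIV (sets borel) (\<lambda>A. ennreal (\<Sum>x\<in>F. v x * indicator A x)). g x)
      = (\<Sum>x\<in>F. v x * g x)"
proof -
  define M where "M = distr (point_measure F (\<lambda>x. ennreal (v x))) (borel :: 'a measure) (\<lambda>x. x)"
  have "emeasure M A = ennreal (\<Sum>x\<in>F. v x * indicator A x)" if "A \<in> sets borel" for A
  proof -
    have "emeasure M A = (\<Sum>x\<in>A \<inter> F. ennreal (v x))"
      unfolding M_def using that F
      by (simp add: emeasure_distr space_point_measure emeasure_point_measure_finite
          measurable_def sets_point_measure)
    also have "\<dots> = ennreal (\<Sum>x\<in>A \<inter> F. v x)"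
      using v by (intro sum_ennreal) auto
    also have "(\<Sum>x\<in>A \<inter> F. v x) = (\<Sum>x\<in>F. v x * indicator A x)"
      using F by (simp add: indicator_def sum.If_cases Int_commute if_distrib Int_def cong: if_cong)
    finally show ?thesis .
  qed
  then have "measure_of UNIV (sets borel) (\<lambda>A. ennreal (\<Sum>x\<in>F. v x * indicator A x))
      = measure_of (space M) (sets M) (emeasure M)"
    using sets.sigma_sets_eq[of "borel :: 'a measure"] by (simp add: M_def) (intro measure_of_eq, auto)
  also have "\<dots> = M"
    by (rule measure_of_of_measure)
  finally show ?thesis
    using F v g by (simp add: M_def integral_distr measurable_def sets_point_measure space_point_measure
        lebesgue_integral_point_measure_finite)
qed

lemma (in point_masses) signed_integral_eq:
  assumes g: "continuous_on UNIV g"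
  shows "signed_integral \<mu> g = (\<Sum>x\<in>F. w x * g x)"
proof -
  have "g \<in> borel_measurable borel"
    using g by (rule borel_measurable_continuous_onI)
  note integral = integral_weighted_point_masses[OF finite_atoms _ this]
  have "upper_variation \<mu> = (\<lambda>A. ennreal (\<Sum>x\<in>F. max 0 (w x) * indicator A x))"
    "lower_variation \<mu> = (\<lambda>A. ennreal (\<Sum>x\<in>F. max 0 (- w x) * indicator A x))"
    by (simp_all add: fun_eq_iff upper_variation_eq lower_variation_eq)
  then have "signed_integral \<mu> g
      = (\<Sum>x\<in>F. max 0 (w x) * g x) - (\<Sum>x\<in>F. max 0 (- w x) * g x)"
    unfolding signed_integral_def by (simp only: integral max.cobounded1)
  also have "\<dots> = (\<Sum>x\<in>F. w x * g x)"
    unfolding sum_subtractf[symmetric] by (rule sum.cong) (auto simp: max_def)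
  finally show ?thesis .
qed

section \<open>Cylinders and clopen sets with almost disjoint images\<close>

definition cylinder :: "bool list \<Rightarrow> (nat \<Rightarrow> bool) set" where
  "cylinder s = {x. \<forall>i<length s. x i = s ! i}"

lemma prob_space_cantor_measure: "prob_space cantor_measure"
  unfolding cantor_measure_def
  by (intro prob_space_PiM prob_space_uniform_count_measure) auto

lemma sets_cylinder: "cylinder s \<in> sets cantor_measure"
  and measure_cylinder: "measure cantor_measure (cylinder s) = 1 / 2 ^ length s"
proof -
  interpret product_prob_space "\<lambda>_::nat. uniform_count_measure (UNIV :: bool set)" UNIV
    by (intro product_prob_spaceI prob_space_uniform_count_measure) auto
  have *: "cylinder s
      = prod_emb UNIV (\<lambda>_. uniform_count_measure UNIV) {..<length s} (\<Pi>\<^sub>E i\<in>{..<length s}. {s ! i})"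
    by (rule set_eqI)
      (simp add: cylinder_def prod_emb_iff space_uniform_count_measure PiE_iff Ball_def)
  show "cylinder s \<in> sets cantor_measure"
    unfolding * cantor_measure_def by (intro sets_PiM_I) (auto simp: sets_uniform_count_measure)
  show "measure cantor_measure (cylinder s) = 1 / 2 ^ length s"
    unfolding * cantor_measure_def
    by (subst measure_PiM_emb) (auto simp: sets_uniform_count_measure measure_uniform_count_measure power_one_over)
qed

lemma finite_bool_lists: "finite {s :: bool list. length s = n}"
  using finite_lists_length_eq[of "UNIV :: bool set" n] by simp

lemma card_bool_lists: "card {s :: bool list. length s = n} = 2 ^ n"
  using card_lists_length_eq[of "UNIV :: bool set" n] by simp

lemma disjoint_cylinders:
  assumes "length s = length t" "s \<noteq> t"
  shows "cylinder s \<inter> cylinder t = {}"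
proof (rule ccontr)
  assume "cylinder s \<inter> cylinder t \<noteq> {}"
  then obtain x where "x \<in> cylinder s" "x \<in> cylinder t" by auto
  then have "s = t"
    using assms(1) by (intro nth_equalityI) (auto simp: cylinder_def)
  with assms(2) show False by simp
qed

lemma measure_UN_cylinder:
  assumes S: "S \<subseteq> {s. length s = n}"
  shows "measure cantor_measure (\<Union>s\<in>S. cylinder s) = card S / 2 ^ n"
proof -
  interpret prob_space cantor_measure
    by (rule prob_space_cantor_measure)
  have "measure cantor_measure (\<Union>s\<in>S. cylinder s) = (\<Sum>s\<in>S. measure cantor_measure (cylinder s))"
  proof (rule finite_measure_finite_Union)
    show "finite S"
      using S finite_bool_lists by (rule finite_subset)
    show "disjoint_family_on cylinder S"
      unfolding disjoint_family_on_def using S by (intro ballI impI disjoint_cylinders) auto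
  qed (auto simp: sets_cylinder)
  also have "\<dots> = (\<Sum>s\<in>S. 1 / 2 ^ n)"
    using S by (intro sum.cong) (auto simp: measure_cylinder)
  finally show ?thesis by simp
qed

text \<open>
  The image of a compact set is closed in the product topology: if \<open>x\<close> were not in it, then each
  point of \<open>U\<close> would differ from \<open>x\<close> in some coordinate after applying \<open>f\<close>, and by compactness
  finitely many coordinates would suffice to see this for all of \<open>U\<close>.
\<close>

lemma mem_image_of_compactI:
  fixes f :: "'a::topological_space \<Rightarrow> nat \<Rightarrow> 'b::t1_space"
  assumes U: "compact U" and f: "continuous_on UNIV f"
    and approx: "\<And>n. \<exists>u\<in>U. \<forall>i<n. f u i = x i"
  shows "x \<in> f ` U"
proof (rule ccontr)
  assume x: "x \<notin> f ` U"
  have "open {u. f u i \<noteq> x i}" for i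
  proof -
    have "continuous_on UNIV (\<lambda>u. f u i)"
      using f by (rule continuous_on_product_then_coordinatewise)
    then have "open ((\<lambda>u. f u i) -` (- {x i}))"
      by (rule open_vimage[rotated]) auto
    then show ?thesis
      by (simp add: vimage_def)
  qed
  moreover have "U \<subseteq> (\<Union>i. {u. f u i \<noteq> x i})"
  proof
    fix u assume "u \<in> U"
    with x have "f u \<noteq> x" by auto
    then show "u \<in> (\<Union>i. {u. f u i \<noteq> x i})"
      by (auto simp: fun_eq_iff)
  qed
  ultimately obtain I where I: "finite I" "U \<subseteq> (\<Union>i\<in>I. {u. f u i \<noteq> x i})"
    by (rule compactE_image[OF U, of UNIV]) auto
  obtain n where n: "I \<subseteq> {..<n}"
    using finite_nat_bounded[OF I(1)] by auto
  from approx[of n] obtain u where "u \<in> U" "\<forall>i<n. f u i = x i" by auto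
  with I(2) n show False by auto
qed

text \<open>
  For any other word of length \<open>n\<close>, the preimage of its cylinder under \<open>f\<close> lies on one side of the
  partition into \<open>U\<close> and its complement.
\<close>

definition split_words :: "('a \<Rightarrow> nat \<Rightarrow> bool) \<Rightarrow> 'a set \<Rightarrow> nat \<Rightarrow> bool list set" where
  "split_words f U n
     = {s. length s = n \<and> cylinder s \<inter> f ` U \<noteq> {} \<and> cylinder s \<inter> f ` (UNIV - U) \<noteq> {}}"

text \<open>
  The fraction is the probability of the union \<open>B n\<close> of the cylinders of the split words of length
  \<open>n\<close>. These unions decrease, and since the images of \<open>U\<close> and of its complement are closed, their
  intersection is the common part of the two images, which is a null set. Continuity from above
  gives the limit.
\<close>

lemma split_words_fraction_tendsto_0:
  fixes f :: "'a::topological_space \<Rightarrow> nat \<Rightarrow> bool"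
  assumes comp: "compact (UNIV :: 'a set)" and f: "continuous_on UNIV f"
    and U: "open U" "closed U"
    and null: "emeasure cantor_measure (f ` U \<inter> f ` (UNIV - U)) = 0"
  shows "(\<lambda>n. card (split_words f U n) / 2 ^ n) \<longlonglongrightarrow> 0"
proof -
  interpret prob_space cantor_measure
    by (rule prob_space_cantor_measure)
  define B where "B n = (\<Union>s\<in>split_words f U n. cylinder s)" for n
  have B_iff: "x \<in> B n \<longleftrightarrow>
      (\<exists>u\<in>U. \<forall>i<n. f u i = x i) \<and> (\<exists>u\<in>UNIV - U. \<forall>i<n. f u i = x i)" for x n
  proof
    assume "x \<in> B n"
    then obtain s u v where "length s = n" "x \<in> cylinder s" "u \<in> U" "f u \<in> cylinder s"
        "v \<in> UNIV - U" "f v \<in> cylinder s"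
      by (auto simp: B_def split_words_def)
    then show "(\<exists>u\<in>U. \<forall>i<n. f u i = x i) \<and> (\<exists>u\<in>UNIV - U. \<forall>i<n. f u i = x i)"
      by (intro conjI bexI[of _ u] bexI[of _ v]) (auto simp: cylinder_def)
  next
    assume "(\<exists>u\<in>U. \<forall>i<n. f u i = x i) \<and> (\<exists>u\<in>UNIV - U. \<forall>i<n. f u i = x i)"
    then have "map x [0..<n] \<in> split_words f U n" "x \<in> cylinder (map x [0..<n])"
      by (auto simp: split_words_def cylinder_def)
    then show "x \<in> B n"
      by (auto simp: B_def)
  qed
  have comp_U: "compact U" "compact (UNIV - U)"
    using compact_Int_closed[OF comp U(2)] compact_diff[OF comp U(1)] by simp_all
  have "(\<Inter>n. B n) = f ` U \<inter> f ` (UNIV - U)"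
  proof (intro equalityI subsetI)
    fix x assume "x \<in> (\<Inter>n. B n)"
    then show "x \<in> f ` U \<inter> f ` (UNIV - U)"
      unfolding INT_iff B_iff by (intro IntI mem_image_of_compactI comp_U f) blast+
  next
    fix x assume "x \<in> f ` U \<inter> f ` (UNIV - U)"
    then obtain u v where "u \<in> U" "f u = x" "v \<in> UNIV - U" "f v = x"
      by fastforce
    then show "x \<in> (\<Inter>n. B n)"
      unfolding INT_iff B_iff by (intro ballI conjI bexI[of _ u] bexI[of _ v]) simp_all
  qed
  moreover have "(\<lambda>n. measure cantor_measure (B n)) \<longlonglongrightarrow> measure cantor_measure (\<Inter>n. B n)"
  proof (rule finite_Lim_measure_decseq)
    have "finite (split_words f U n)" for n
      by (rule finite_subset[OF _ finite_bool_lists[of n]]) (auto simp: split_words_def)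
    then show "range B \<subseteq> sets cantor_measure"
      unfolding B_def by (auto intro!: sets.finite_UN sets_cylinder)
    show "decseq B"
    proof (intro decseq_SucI subsetI)
      fix n x assume "x \<in> B (Suc n)"
      then show "x \<in> B n"
        unfolding B_iff by (meson less_SucI)
    qed
  qed
  moreover have "measure cantor_measure (B n) = card (split_words f U n) / 2 ^ n" for n
    unfolding B_def by (rule measure_UN_cylinder) (auto simp: split_words_def)
  ultimately show ?thesis
    using null by (simp add: measure_def)
qed

lemma append_const_mem_cylinder: "append_const s i \<in> cylinder s"
  by (simp add: append_const_def cylinder_def)

section \<open>Approximation by continuous functions of finite range\<close>

text \<open>
  In a compact Hausdorff space components and quasi-components coincide, so points in different
  components are separated by a clopen set.
\<close>

lemma clopen_separation:
  fixes x z :: "'a::t2_space"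
  assumes comp: "compact (UNIV :: 'a set)" and td: "totally_disconnected (UNIV :: 'a set)"
    and "x \<noteq> z"
  obtains U where "open U" "closed U" "x \<in> U" "z \<notin> U"
proof -
  have sp: "compact_space (euclidean :: 'a topology)" "Hausdorff_space (euclidean :: 'a topology)"
    using comp by (auto simp: compact_space_def Hausdorff_space_def disjnt_def separation_t2)
  have "\<not> connected_component_of euclidean x z"
  proof
    assume "connected_component_of euclidean x z"
    then obtain T where T: "connected T" "x \<in> T" "z \<in> T"
      by (auto simp: connected_component_of_def)
    then have "z \<in> connected_component_set UNIV x"
      by (auto simp: connected_component_def)
    with td \<open>x \<noteq> z\<close> show False
      by (auto simp: totally_disconnected_def)
  qed
  then have "\<not> quasi_component_of euclidean x z"
    using quasi_eq_connected_component_of[of "euclidean :: 'a topology" x] sp by simp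
  then obtain T where T: "closed T" "open T" "(x \<in> T) \<noteq> (z \<in> T)"
    by (auto simp: quasi_component_of_def)
  then show thesis
    using that[of T] that[of "- T"] by (cases "x \<in> T") (auto intro: open_Compl closed_Compl)
qed

text \<open>
  This is the Stone--Weierstrass theorem: the continuous functions of finite range form an algebra,
  and it separates points because indicators of clopen sets belong to it.
\<close>

lemma finite_range_approximation:
  fixes g :: "'a::t2_space \<Rightarrow> real"
  assumes comp: "compact (UNIV :: 'a set)" and td: "totally_disconnected (UNIV :: 'a set)"
    and g: "continuous_on UNIV g" and "0 < e"
  obtains h where "continuous_on UNIV h" "finite (range h)" "\<And>x. \<bar>g x - h x\<bar> < e"
proof -
  define R where "R = {h :: 'a \<Rightarrow> real. continuous_on UNIV h \<and> finite (range h)}"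
  interpret function_ring_on R UNIV
  proof
    show "compact (UNIV :: 'a set)" by (rule comp)
  next
    fix p q :: "'a \<Rightarrow> real" assume pq: "p \<in> R" "q \<in> R"
    have fin: "finite (range (\<lambda>x. op (p x) (q x)))" for op :: "real \<Rightarrow> real \<Rightarrow> real"
      by (rule finite_subset[of _ "(\<lambda>(a, b). op a b) ` (range p \<times> range q)"])
        (use pq in \<open>auto simp: R_def\<close>)
    show "(\<lambda>x. p x + q x) \<in> R" "(\<lambda>x. p x * q x) \<in> R"
      using pq fin by (auto simp: R_def intro: continuous_on_add continuous_on_mult)
  next
    fix x z :: 'a assume "x \<noteq> z"
    then obtain U where U: "open U" "closed U" "x \<in> U" "z \<notin> U"
      by (rule clopen_separation[OF comp td])
    have "continuous_on (U \<union> - U) (\<lambda>x. if x \<in> U then 1 else 0 :: real)"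
      using U by (intro continuous_on_cases) (auto intro: closed_Compl)
    then have "continuous_on UNIV (indicator U :: 'a \<Rightarrow> real)"
      by (simp add: indicator_def [abs_def] of_bool_def Compl_partition)
    moreover have "finite (range (indicator U :: 'a \<Rightarrow> real))"
      by (rule finite_subset[of _ "{0, 1}"]) (auto simp: indicator_def)
    ultimately show "\<exists>f\<in>R. f x \<noteq> f z"
      using U by (intro bexI[of _ "indicator U"]) (auto simp: R_def)
  qed (auto simp: R_def)
  from Stone_Weierstrass_basic[OF g \<open>0 < e\<close>] show thesis
    using that by (auto simp: R_def)
qed

lemma clopen_level_set:
  fixes h :: "'a::topological_space \<Rightarrow> 'b::t1_space"
  assumes h: "continuous_on UNIV h" and fin: "finite (range h)"
  shows "open (h -` {c})" "closed (h -` {c})"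
proof -
  show "closed (h -` {c})"
    using h by (intro closed_vimage) auto
  have "h -` {c} = h -` (- (range h - {c}))"
    by auto
  also have "open \<dots>"
    using h fin by (intro open_vimage open_Compl finite_imp_closed) auto
  finally show "open (h -` {c})" .
qed

lemma finite_range_eq_sum_indicator:
  fixes h :: "'a \<Rightarrow> real"
  assumes "finite (range h)"
  shows "h x = (\<Sum>c\<in>range h. c * indicator (h -` {c}) x)"
  using assms by (simp add: indicator_def if_distrib cong: if_cong)

section \<open>Averaged differences over the ends of cylinders\<close>

text \<open>
  This is the integral of \<open>h\<close> against the measure \<open>\<nu> n\<close> of the theorem.
\<close>

definition end_difference :: "(bool \<Rightarrow> bool list \<Rightarrow> 'a) \<Rightarrow> nat \<Rightarrow> ('a \<Rightarrow> real) \<Rightarrow> real" where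
  "end_difference y n h = 1 / 2 ^ (n + 1) * (\<Sum>s | length s = n. h (y True s) - h (y False s))"

lemma end_difference_sum:
  "end_difference y n (\<lambda>x. \<Sum>c\<in>C. a c * h c x) = (\<Sum>c\<in>C. a c * end_difference y n (h c))"
proof -
  have "end_difference y n (\<lambda>x. \<Sum>c\<in>C. a c * h c x)
      = 1 / 2 ^ (n + 1) * (\<Sum>s | length s = n. \<Sum>c\<in>C. a c * (h c (y True s) - h c (y False s)))"
    by (simp add: end_difference_def sum_subtractf right_diff_distrib)
  also have "\<dots> = 1 / 2 ^ (n + 1) * (\<Sum>c\<in>C. a c * (\<Sum>s | length s = n. h c (y True s) - h c (y False s)))"
    by (subst sum.swap) (simp add: sum_distrib_left)
  finally show ?thesis
    by (simp add: end_difference_def sum_distrib_left mult.left_commute)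
qed

lemma end_difference_diff:
  "end_difference y n (\<lambda>x. g x - h x) = end_difference y n g - end_difference y n h"
  unfolding end_difference_def right_diff_distrib[symmetric] sum_subtractf[symmetric]
  by (simp add: algebra_simps)

text \<open>
  Only words in \<open>T\<close> contribute, each by at most \<open>d / 2 ^ (n + 1)\<close>. For the indicator of a clopen set,
  \<open>T\<close> is the small set of split words; for the uniform bound it is the set of all words.
\<close>

lemma abs_end_difference_le_card:
  assumes "\<And>s. length s = n \<Longrightarrow> s \<notin> T \<Longrightarrow> h (y True s) = h (y False s)"
    and "\<And>s. length s = n \<Longrightarrow> \<bar>h (y True s) - h (y False s)\<bar> \<le> d"
    and T: "T \<subseteq> {s. length s = n}"
  shows "\<bar>end_difference y n h\<bar> \<le> d / 2 * (card T / 2 ^ n)"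
proof -
  have "(\<Sum>s | length s = n. h (y True s) - h (y False s)) = (\<Sum>s\<in>T. h (y True s) - h (y False s))"
    using assms by (intro sum.mono_neutral_right finite_bool_lists) auto
  moreover have "\<bar>\<Sum>s\<in>T. h (y True s) - h (y False s)\<bar> \<le> (\<Sum>s\<in>T. d)"
    by (rule order_trans[OF sum_abs sum_mono]) (use assms in auto)
  ultimately show ?thesis
    by (simp add: end_difference_def abs_mult divide_right_mono field_simps)
qed

lemma abs_end_difference_le:
  assumes "\<And>x. \<bar>h x\<bar> \<le> e"
  shows "\<bar>end_difference y n h\<bar> \<le> e"
proof -
  have "\<bar>h (y True s) - h (y False s)\<bar> \<le> 2 * e" for s
    using assms[of "y True s"] assms[of "y False s"] by linarith
  then have "\<bar>end_difference y n h\<bar> \<le> 2 * e / 2 * (card {s :: bool list. length s = n} / 2 ^ n)"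
    by (intro abs_end_difference_le_card) auto
  then show ?thesis
    by (simp add: card_bool_lists)
qed

text \<open>
  Both chosen points over a word \<open>s\<close> are mapped into the cylinder of \<open>s\<close>. Hence if \<open>s\<close> is not
  split, they lie on the same side of \<open>U\<close> and their contributions cancel.
\<close>

lemma end_difference_clopen_tendsto_0:
  fixes f :: "'a::topological_space \<Rightarrow> nat \<Rightarrow> bool"
  assumes comp: "compact (UNIV :: 'a set)" and f: "continuous_on UNIV f"
    and lift: "\<And>i s. f (y i s) = append_const s i"
    and U: "open U" "closed U"
    and null: "emeasure cantor_measure (f ` U \<inter> f ` (UNIV - U)) = 0"
  shows "(\<lambda>n. end_difference y n (indicator U)) \<longlonglongrightarrow> 0"
proof (rule Lim_null_comparison)
  have lifts_in_cylinder: "f (y i s) \<in> cylinder s" for i s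
    by (simp add: lift append_const_mem_cylinder)
  have "\<bar>end_difference y n (indicator U)\<bar> \<le> 1 / 2 * (card (split_words f U n) / 2 ^ n)" for n
  proof (rule abs_end_difference_le_card)
    fix s assume s: "length s = n" "s \<notin> split_words f U n"
    have "y True s \<in> U \<longleftrightarrow> y False s \<in> U"
      using s lifts_in_cylinder[of True s] lifts_in_cylinder[of False s]
      unfolding split_words_def by blast
    then show "indicator U (y True s) = (indicator U (y False s) :: real)"
      by (simp add: indicator_def)
  qed (auto simp: split_words_def indicator_def)
  then show "\<forall>\<^sub>F n in sequentially.
      norm (end_difference y n (indicator U)) \<le> 1 / 2 * (card (split_words f U n) / 2 ^ n)"
    by simp
  show "(\<lambda>n. 1 / 2 * (card (split_words f U n) / 2 ^ n)) \<longlonglongrightarrow> 0"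
    by (rule tendsto_mult_right_zero)
      (rule split_words_fraction_tendsto_0[OF comp f U null])
qed

text \<open>
  Convergence passes from indicators of clopen sets to their linear combinations, and from there to
  uniform limits, because the functionals are uniformly bounded by the supremum norm.
\<close>

lemma end_difference_continuous_tendsto_0:
  fixes g :: "'a::t2_space \<Rightarrow> real"
  assumes comp: "compact (UNIV :: 'a set)" and td: "totally_disconnected (UNIV :: 'a set)"
    and clopen: "\<And>U. open U \<Longrightarrow> closed U \<Longrightarrow> (\<lambda>n. end_difference y n (indicator U)) \<longlonglongrightarrow> 0"
    and g: "continuous_on UNIV g"
  shows "(\<lambda>n. end_difference y n g) \<longlonglongrightarrow> 0"
proof (rule LIMSEQ_I)
  fix e :: real assume "0 < e"
  then have "0 < e / 2" by simp
  then obtain h where h: "continuous_on UNIV h" "finite (range h)" "\<And>x. \<bar>g x - h x\<bar> < e / 2"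
    using finite_range_approximation[OF comp td g] by metis
  have "(\<lambda>n. \<Sum>c\<in>range h. c * end_difference y n (indicator (h -` {c}))) \<longlonglongrightarrow> (\<Sum>c\<in>range h. c * 0)"
    by (intro tendsto_sum tendsto_mult_left clopen clopen_level_set[OF h(1,2)])
  moreover have "end_difference y n h
      = (\<Sum>c\<in>range h. c * end_difference y n (indicator (h -` {c})))" for n
  proof -
    have "h = (\<lambda>x. \<Sum>c\<in>range h. c * indicator (h -` {c}) x)"
      using finite_range_eq_sum_indicator[OF h(2)] by (rule ext)
    then have "end_difference y n h
        = end_difference y n (\<lambda>x. \<Sum>c\<in>range h. c * indicator (h -` {c}) x)"
      by (rule arg_cong)
    also have "\<dots> = (\<Sum>c\<in>range h. c * end_difference y n (indicator (h -` {c})))"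
      by (rule end_difference_sum)
    finally show ?thesis .
  qed
  ultimately have "(\<lambda>n. end_difference y n h) \<longlonglongrightarrow> 0"
    by simp
  from LIMSEQ_D[OF this \<open>0 < e / 2\<close>]
  obtain N where N: "\<bar>end_difference y n h\<bar> < e / 2" if "N \<le> n" for n
    by auto
  have "\<bar>end_difference y n (\<lambda>x. g x - h x)\<bar> \<le> e / 2" for n
    using h(3) by (intro abs_end_difference_le) (simp add: less_imp_le)
  then have "\<bar>end_difference y n g\<bar> < e" if "N \<le> n" for n
    using N[OF that] unfolding end_difference_diff by (smt (verit) field_sum_of_halves)
  then show "\<exists>N. \<forall>n\<ge>N. norm (end_difference y n g - 0) < e"
    by auto
qed

text \<open>
  If the words have the same length \<open>n\<close>, the sequences determine the words by their first \<open>n\<close>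
  coordinates and the constants by the coordinate at \<open>n\<close>. Thus the \<open>2 ^ (n + 1)\<close> atoms of \<open>\<nu> n\<close> are
  distinct, and no mass cancels in its norm.
\<close>

lemma append_const_inject:
  assumes len: "length s = length t" and eq: "append_const s i = append_const t j"
  shows "s = t" "i = j"
proof -
  show "s = t"
  proof (rule nth_equalityI[OF len])
    fix k assume "k < length s"
    then show "s ! k = t ! k"
      using fun_cong[OF eq, of k] len by (simp add: append_const_def)
  qed
  show "i = j"
    using fun_cong[OF eq, of "length s"] len by (simp add: append_const_def)
qed

section \<open>The sequence of measures\<close>

theorem proposition9p17:
  fixes f :: "'a::t2_space \<Rightarrow> nat \<Rightarrow> bool"
    and y :: "bool \<Rightarrow> bool list \<Rightarrow> 'a"
    and \<nu> :: "nat \<Rightarrow> 'a set \<Rightarrow> real"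
  assumes "compact (UNIV :: 'a set)"
    and "totally_disconnected (UNIV :: 'a set)"
    and "continuous_on UNIV f"
    and "surj f"
    and "\<And>U. open U \<Longrightarrow> closed U \<Longrightarrow> emeasure cantor_measure (f ` U \<inter> f ` (UNIV - U)) = 0"
    and "\<And>i s. y i s \<in> f -` {append_const s i}"
    and "\<And>n. \<nu> n = (\<lambda>A. 1 / 2 ^ (n + 1) *
           (\<Sum>s | length s = n. measure (return borel (y True s)) A - measure (return borel (y False s)) A))"
  shows "fsJN_sequence \<nu>"
proof -
  have lift: "f (y i s) = append_const s i" for i s
    using assms(6) by blast
  define S where "S n = {s :: bool list. length s = n}" for n
  define F where "F n = y True ` S n \<union> y False ` S n" for n
  define w where "w n x = (if x \<in> y True ` S n then 1 else - 1) / (2 ^ (n + 1) :: real)" for n x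
  have distinct: "s = t \<and> i = j" if "y i s = y j t" "s \<in> S n" "t \<in> S n" for i j s t n
    using that append_const_inject[of s t i j] lift[of i s] lift[of j t] by (auto simp: S_def)
  have inj: "inj_on (y i) (S n)" for i n
    using distinct by (auto intro: inj_onI)
  have disjoint: "y True ` S n \<inter> y False ` S n = {}" for n
    using distinct by blast
  have fin: "finite (S n)" for n
    unfolding S_def by (rule finite_bool_lists)
  have sum_F: "(\<Sum>x\<in>F n. k x)
      = (\<Sum>s\<in>S n. k (y True s)) + (\<Sum>s\<in>S n. k (y False s))" for k :: "'a \<Rightarrow> real" and n
    unfolding F_def using fin inj disjoint by (simp add: sum.union_disjoint sum.reindex)
  have w_True: "w n (y True s) = 1 / 2 ^ (n + 1)" if "s \<in> S n" for n s
    using that by (simp add: w_def)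
  have w_False: "w n (y False s) = - 1 / 2 ^ (n + 1)" if "s \<in> S n" for n s
    using that disjoint[of n] by (auto simp: w_def)
  have sum_w: "(\<Sum>x\<in>F n. w n x * h x) = end_difference y n h" for n h
  proof -
    have "(\<Sum>x\<in>F n. w n x * h x)
        = (\<Sum>s\<in>S n. 1 / 2 ^ (n + 1) * h (y True s)) + (\<Sum>s\<in>S n. - 1 / 2 ^ (n + 1) * h (y False s))"
      unfolding sum_F by (intro arg_cong2[of _ _ _ _ "(+)"] sum.cong) (simp_all only: w_True w_False)
    also have "\<dots> = end_difference y n h"
      unfolding end_difference_def S_def[symmetric] sum.distrib[symmetric] sum_distrib_left
      by (rule sum.cong) (simp_all add: diff_divide_distrib)
    finally show ?thesis .
  qed
  have masses: "point_masses (\<nu> n) (F n) (w n)" for n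
  proof
    show "finite (F n)"
      using fin by (simp add: F_def)
    show "\<nu> n B = (\<Sum>x\<in>F n. w n x * indicator B x)" if "B \<in> sets borel" for B
      unfolding sum_w assms(7) end_difference_def using that by (simp add: measure_return)
  qed
  have abs_w: "\<bar>w n x\<bar> = 1 / 2 ^ (n + 1)" for n x
    by (simp add: w_def)
  have "tv_norm (\<nu> n) = 1" for n
  proof -
    have "(\<Sum>x\<in>F n. \<bar>w n x\<bar>) = 1"
      unfolding sum_F abs_w by (simp add: S_def card_bool_lists)
    then show ?thesis
      by (simp add: point_masses.tv_norm_eq[OF masses])
  qed
  moreover have "(\<lambda>n. signed_integral (\<nu> n) g) \<longlonglongrightarrow> 0" if g: "continuous_on UNIV g" for g
  proof -
    have "(\<lambda>n. end_difference y n g) \<longlonglongrightarrow> 0"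
      using end_difference_clopen_tendsto_0[OF assms(1,3) lift _ _ assms(5)]
      by (intro end_difference_continuous_tendsto_0[OF assms(1,2) _ g]) auto
    then show ?thesis
      by (simp add: point_masses.signed_integral_eq[OF masses g] sum_w)
  qed
  ultimately show ?thesis
    unfolding fsJN_sequence_def
    using point_masses.signed_radon_measure[OF masses] point_masses.finite_signed_support[OF masses]
    by blast
qed

end
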